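(* Let $\mathrm{L}$ be a connected $4$-dimensional Lie group of the family described in the context (with real parameters $(\lambda_1,\lambda_2,\lambda_3,\lambda_4)\neq(0,0,0,0)$), with the left-invariant metric $g$ and the left-invariant structure $H=(J_1,J_2,J_3)$ given there, and let $G=(g,\Phi,g_2,g_3)$, where $\Phi(x,y)=g(J_1x,y)$, $g_2(x,y)=g(J_2x,y)$, $g_3(x,y)=g(J_3x,y)$. Then $(\mathrm{L},H,G)$ is an almost hypercomplex pseudo-Hermitian manifold of dimension $4$.
   Context: The Lie group. $\mathrm{L}$ is a connected Lie group whose Lie algebra has a global basis of left-invariant vector fields $\{X_1,X_2,X_3,X_4\}$ with $$[X_1,X_3]=\lambda_2X_2+\lambda_4X_4,\quad [X_2,X_4]=\lambda_1X_1+\lambda_3X_3,\quad [X_2,X_3]=-\lambda_2X_1-\lambda_3X_4,$$ $$[X_3,X_4]=-\lambda_4X_1+\lambda_3X_2,\quad [X_4,X_1]=\lambda_1X_2+\lambda_4X_3,\quad [X_2,X_1]=-\lambda_2X_3+\lambda_1X_4,$$ where $\lambda_i\in\mathbb{R}$ and $(\lambda_1,\lambda_2,\lambda_3,\lambda_4)\neq(0,0,0,0)$. The metric. $g$ is the left-invariant pseudo-Riemannian metric with $g(X_1,X_1)=g(X_2,X_2)=-g(X_3,X_3)=-g(X_4,X_4)=1$ and $g(X_i,X_j)=0$ for $i\ne j$; it satisfies $g([X_i,X_j],X_k)+g([X_i,X_k],X_j)=0$. The structure $H$. $J_1X_1=X_2,\ J_1X_2=-X_1,\ J_1X_3=-X_4,\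 J_1X_4=X_3$; $J_2X_1=X_3,\ J_2X_2=X_4,\ J_2X_3=-X_1,\ J_2X_4=-X_2$; $J_3=J_1J_2$. An almost hypercomplex pseudo-Hermitian manifold is a smooth manifold $M$ with an almost hypercomplex structure $H=(J_1,J_2,J_3)$, i.e. a triple of pairwise anticommuting almost complex structures with $J_3=J_1J_2$, and a pseudo-Hermitian metric $g$, i.e. a pseudo-Riemannian metric with $g(J_1x,J_1y)=-g(J_2x,J_2y)=-g(J_3x,J_3y)=g(x,y)$ for all tangent vectors $x,y$ at the same point, together with the associated tensors $\Phi,g_2,g_3$ collected in $G=(g,\Phi,g_2,g_3)$. *)

theory Defs
  imports "HOL-Analysis.Analysis" "HOL-Algebra.Group" "HOL-Library.Function_Algebras"
begin

text \<open>Pointwise scalar multiplication, so that tangent vectors and vector fields (which are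
  represented by functions) form real vector spaces.\<close>

instantiation "fun" :: (type, real_vector) real_vector
begin

definition scaleR_fun :: "real \<Rightarrow> ('a \<Rightarrow> 'b) \<Rightarrow> 'a \<Rightarrow> 'b"
  where "scaleR_fun r f = (\<lambda>x. r *\<^sub>R f x)"

instance
  by standard (auto simp: scaleR_fun_def fun_eq_iff scaleR_add_right scaleR_add_left)

end


section \<open>Smooth manifolds\<close>

text \<open>\<open>Ck k S f\<close> means that \<open>f\<close> is \<open>k\<close> times continuously differentiable; it is only used for
  open \<open>S\<close>.\<close>

primrec Ck :: "nat \<Rightarrow> 'e::euclidean_space set \<Rightarrow> ('e \<Rightarrow> 'b::real_normed_vector) \<Rightarrow> bool" where
  "Ck 0 S f \<longleftrightarrow> continuous_on S f"
| "Ck (Suc k) S f \<longleftrightarrow>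
     f differentiable_on S \<and> (\<forall>v. Ck k S (\<lambda>x. frechet_derivative f (at x) v))"

definition smooth_on :: "'e::euclidean_space set \<Rightarrow> ('e \<Rightarrow> 'b::real_normed_vector) \<Rightarrow> bool"
  where "smooth_on S f \<longleftrightarrow> (\<forall>k. Ck k S f)"

text \<open>A chart is a pair of its domain and its coordinate map; the values of the map
  outside the domain are irrelevant.\<close>

type_synonym ('a, 'e) chart = "'a set \<times> ('a \<Rightarrow> 'e)"

abbreviation chart_dom :: "('a, 'e) chart \<Rightarrow> 'a set" where "chart_dom \<equiv> fst"

abbreviation chart_map :: "('a, 'e) chart \<Rightarrow> 'a \<Rightarrow> 'e" where "chart_map \<equiv> snd"

definition chart_inv :: "('a, 'e) chart \<Rightarrow> 'e \<Rightarrow> 'a"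
  where "chart_inv c = inv_into (chart_dom c) (chart_map c)"

definition chart_img :: "('a, 'e) chart \<Rightarrow> 'e set"
  where "chart_img c = chart_map c ` chart_dom c"

definition is_chart :: "('a::topological_space, 'e::euclidean_space) chart \<Rightarrow> bool"
  where "is_chart c \<longleftrightarrow> open (chart_dom c) \<and> open (chart_img c) \<and>
    homeomorphism (chart_dom c) (chart_img c) (chart_map c) (chart_inv c)"

definition transition :: "('a, 'e) chart \<Rightarrow> ('a, 'e) chart \<Rightarrow> 'e \<Rightarrow> 'e"
  where "transition c d = chart_map d \<circ> chart_inv c"

text \<open>The underlying set of a manifold is a whole type; its Hausdorff and second countable
  topology is the one given by the type class. The smooth structure is given by a smooth atlas,
  which need not be maximal. All notions below are relative to this atlas, but two atlases
  of the same smooth structure yield the same notions.\<close>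

definition smooth_manifold ::
  "('a::{t2_space, second_countable_topology}, 'e::euclidean_space) chart set \<Rightarrow> bool"
  where "smooth_manifold A \<longleftrightarrow>
    (\<forall>c\<in>A. is_chart c) \<and> (\<Union>c\<in>A. chart_dom c) = UNIV \<and>
    (\<forall>c\<in>A. \<forall>d\<in>A. smooth_on (chart_map c ` (chart_dom c \<inter> chart_dom d)) (transition c d))"

definition manifold_dim :: "('a, 'e::euclidean_space) chart set \<Rightarrow> nat"
  where "manifold_dim A = DIM('e)"

definition smooth_map ::
  "('a::topological_space, 'e::euclidean_space) chart set \<Rightarrow>
   ('b::topological_space, 'f::euclidean_space) chart set \<Rightarrow> ('a \<Rightarrow> 'b) \<Rightarrow> bool"
  where "smooth_map A B F \<longleftrightarrow> continuous_on UNIV F \<and>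
    (\<forall>c\<in>A. \<forall>d\<in>B. smooth_on (chart_map c ` (chart_dom c \<inter> F -` chart_dom d))
       (chart_map d \<circ> F \<circ> chart_inv c))"

definition prod_atlas ::
  "('a, 'e) chart set \<Rightarrow> ('b, 'f) chart set \<Rightarrow> ('a \<times> 'b, 'e \<times> 'f) chart set"
  where "prod_atlas A B =
    (\<lambda>(c, d). (chart_dom c \<times> chart_dom d, map_prod (chart_map c) (chart_map d))) ` (A \<times> B)"


section \<open>Tangent vectors and vector fields\<close>

text \<open>A tangent vector at \<open>p\<close> is the family of its coordinate representations in the charts
  around \<open>p\<close>, which are related by the Jacobians of the transition maps. The value is
  \<open>0\<close> at the irrelevant charts, so that equality of functions is equality of tangent vectors.\<close>

type_synonym ('a, 'e) tangent = "('a, 'e) chart \<Rightarrow> 'e"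

definition tangent_space ::
  "('a, 'e::euclidean_space) chart set \<Rightarrow> 'a \<Rightarrow> ('a, 'e) tangent set"
  where "tangent_space A p = {v.
    (\<forall>c. c \<notin> A \<or> p \<notin> chart_dom c \<longrightarrow> v c = 0) \<and>
    (\<forall>c\<in>A. \<forall>d\<in>A. p \<in> chart_dom c \<and> p \<in> chart_dom d \<longrightarrow>
       v d = frechet_derivative (transition c d) (at (chart_map c p)) (v c))}"

text \<open>The tangent vector at \<open>p\<close> that is represented by \<open>u\<close> in the chart \<open>c\<close>; for basis vectors
  \<open>u\<close> these are the coordinate vectors of \<open>c\<close>.\<close>

definition coord_vector ::
  "('a, 'e::euclidean_space) chart set \<Rightarrow> ('a, 'e) chart \<Rightarrow> 'e \<Rightarrow> 'a \<Rightarrow> ('a, 'e) tangent"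
  where "coord_vector A c u p = (\<lambda>d. if d \<in> A \<and> p \<in> chart_dom d
    then frechet_derivative (transition c d) (at (chart_map c p)) u else 0)"

text \<open>The chart chosen at \<open>p\<close> does not matter, by the chain rule.\<close>

definition differential ::
  "('a, 'e::euclidean_space) chart set \<Rightarrow> ('b, 'f::euclidean_space) chart set \<Rightarrow>
   ('a \<Rightarrow> 'b) \<Rightarrow> 'a \<Rightarrow> ('a, 'e) tangent \<Rightarrow> ('b, 'f) tangent"
  where "differential A B F p v = (let c = (SOME c. c \<in> A \<and> p \<in> chart_dom c) in
    (\<lambda>d. if d \<in> B \<and> F p \<in> chart_dom d
      then frechet_derivative (chart_map d \<circ> F \<circ> chart_inv c) (at (chart_map c p)) (v c)
      else 0))"

type_synonym ('a, 'e) vector_field = "'a \<Rightarrow> ('a, 'e) tangent"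

definition smooth_vector_field ::
  "('a, 'e::euclidean_space) chart set \<Rightarrow> ('a, 'e) vector_field \<Rightarrow> bool"
  where "smooth_vector_field A X \<longleftrightarrow> (\<forall>p. X p \<in> tangent_space A p) \<and>
    (\<forall>c\<in>A. smooth_on (chart_img c) (\<lambda>x. X (chart_inv c x) c))"

text \<open>In coordinates, the bracket of \<open>X\<close> and \<open>Y\<close> is \<open>DY X - DX Y\<close>, which corresponds to
  the commutator \<open>X Y - Y X\<close> of derivations.\<close>

definition lie_bracket ::
  "('a, 'e::euclidean_space) chart set \<Rightarrow> ('a, 'e) vector_field \<Rightarrow> ('a, 'e) vector_field \<Rightarrow>
   ('a, 'e) vector_field"
  where "lie_bracket A X Y = (\<lambda>p c. if c \<in> A \<and> p \<in> chart_dom c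
    then frechet_derivative (\<lambda>x. Y (chart_inv c x) c) (at (chart_map c p)) (X p c) -
         frechet_derivative (\<lambda>x. X (chart_inv c x) c) (at (chart_map c p)) (Y p c)
    else 0)"


section \<open>Lie groups\<close>

definition lie_group ::
  "'a::{t2_space, second_countable_topology} monoid \<Rightarrow> ('a, 'e::euclidean_space) chart set \<Rightarrow> bool"
  where "lie_group L A \<longleftrightarrow> smooth_manifold A \<and> group L \<and> carrier L = UNIV \<and>
    smooth_map (prod_atlas A A) A (\<lambda>(x, y). x \<otimes>\<^bsub>L\<^esub> y) \<and> smooth_map A A (m_inv L)"

definition left_invariant ::
  "'a monoid \<Rightarrow> ('a, 'e::euclidean_space) chart set \<Rightarrow> ('a, 'e) vector_field \<Rightarrow> bool"
  where "left_invariant L A X \<longleftrightarrow>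
    (\<forall>a p. differential A A (\<lambda>x. a \<otimes>\<^bsub>L\<^esub> x) p (X p) = X (a \<otimes>\<^bsub>L\<^esub> p))"

definition lie_algebra ::
  "'a monoid \<Rightarrow> ('a, 'e::euclidean_space) chart set \<Rightarrow> ('a, 'e) vector_field set"
  where "lie_algebra L A = {X. smooth_vector_field A X \<and> left_invariant L A X}"


section \<open>Tensor fields\<close>

text \<open>Only the values of a tensor field on tangent vectors matter; in particular two fields are
  the same if they agree on all tangent spaces.\<close>

type_synonym ('a, 'e) endo_field = "'a \<Rightarrow> ('a, 'e) tangent \<Rightarrow> ('a, 'e) tangent"

type_synonym ('a, 'e) bilin_field = "'a \<Rightarrow> ('a, 'e) tangent \<Rightarrow> ('a, 'e) tangent \<Rightarrow> real"

definition endomorphism_field ::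
  "('a, 'e::euclidean_space) chart set \<Rightarrow> ('a, 'e) endo_field \<Rightarrow> bool"
  where "endomorphism_field A J \<longleftrightarrow>
    (\<forall>p. \<forall>v\<in>tangent_space A p. J p v \<in> tangent_space A p \<and>
       (\<forall>r. J p (r *\<^sub>R v) = r *\<^sub>R J p v) \<and>
       (\<forall>w\<in>tangent_space A p. J p (v + w) = J p v + J p w))"

definition bilinear_field ::
  "('a, 'e::euclidean_space) chart set \<Rightarrow> ('a, 'e) bilin_field \<Rightarrow> bool"
  where "bilinear_field A b \<longleftrightarrow>
    (\<forall>p. \<forall>v\<in>tangent_space A p. \<forall>w\<in>tangent_space A p.
       (\<forall>r. b p (r *\<^sub>R v) w = r * b p v w \<and> b p v (r *\<^sub>R w) = r * b p v w) \<and>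
       (\<forall>u\<in>tangent_space A p. b p (u + v) w = b p u w + b p v w \<and>
                              b p w (u + v) = b p w u + b p w v))"

text \<open>Smoothness of tensor fields: smoothness of their components in every chart of the atlas.\<close>

definition smooth_endomorphism_field ::
  "('a, 'e::euclidean_space) chart set \<Rightarrow> ('a, 'e) endo_field \<Rightarrow> bool"
  where "smooth_endomorphism_field A J \<longleftrightarrow> endomorphism_field A J \<and>
    (\<forall>c\<in>A. \<forall>u\<in>Basis. smooth_on (chart_img c)
       (\<lambda>x. J (chart_inv c x) (coord_vector A c u (chart_inv c x)) c))"

definition smooth_bilinear_field ::
  "('a, 'e::euclidean_space) chart set \<Rightarrow> ('a, 'e) bilin_field \<Rightarrow> bool"
  where "smooth_bilinear_field A b \<longleftrightarrow> bilinear_field A b \<and>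
    (\<forall>c\<in>A. \<forall>u\<in>Basis. \<forall>w\<in>Basis. smooth_on (chart_img c)
       (\<lambda>x. b (chart_inv c x) (coord_vector A c u (chart_inv c x))
                              (coord_vector A c w (chart_inv c x))))"

text \<open>Besides nondegeneracy, the signature is required to be the same at all points: \<open>k\<close> is the
  number of basis vectors of square \<open>- 1\<close> in an orthonormal basis \<open>B\<close> of the tangent space.\<close>

definition pseudo_riemannian_metric ::
  "('a, 'e::euclidean_space) chart set \<Rightarrow> ('a, 'e) bilin_field \<Rightarrow> bool"
  where "pseudo_riemannian_metric A g \<longleftrightarrow> smooth_bilinear_field A g \<and>
    (\<forall>p. \<forall>v\<in>tangent_space A p. \<forall>w\<in>tangent_space A p. g p v w = g p w v) \<and>
    (\<forall>p. \<forall>v\<in>tangent_space A p. (\<forall>w\<in>tangent_space A p. g p v w = 0) \<longrightarrow> v = 0) \<and>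
    (\<exists>k. \<forall>p. \<exists>B. finite B \<and> independent B \<and> span B = tangent_space A p \<and>
       (\<forall>v\<in>B. \<forall>w\<in>B. v \<noteq> w \<longrightarrow> g p v w = 0) \<and> (\<forall>v\<in>B. g p v v = 1 \<or> g p v v = - 1) \<and>
       card {v\<in>B. g p v v = - 1} = k)"


section \<open>Almost hypercomplex pseudo-Hermitian structures\<close>

definition almost_complex_structure ::
  "('a, 'e::euclidean_space) chart set \<Rightarrow> ('a, 'e) endo_field \<Rightarrow> bool"
  where "almost_complex_structure A J \<longleftrightarrow> smooth_endomorphism_field A J \<and>
    (\<forall>p. \<forall>v\<in>tangent_space A p. J p (J p v) = - v)"

definition anticommuting ::
  "('a, 'e::euclidean_space) chart set \<Rightarrow> ('a, 'e) endo_field \<Rightarrow> ('a, 'e) endo_field \<Rightarrow> bool"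
  where "anticommuting A J K \<longleftrightarrow> (\<forall>p. \<forall>v\<in>tangent_space A p. J p (K p v) = - K p (J p v))"

definition is_composition ::
  "('a, 'e::euclidean_space) chart set \<Rightarrow> ('a, 'e) endo_field \<Rightarrow> ('a, 'e) endo_field \<Rightarrow>
   ('a, 'e) endo_field \<Rightarrow> bool"
  where "is_composition A I J K \<longleftrightarrow> (\<forall>p. \<forall>v\<in>tangent_space A p. I p v = J p (K p v))"

definition almost_hypercomplex_structure ::
  "('a, 'e::euclidean_space) chart set \<Rightarrow>
   ('a, 'e) endo_field \<times> ('a, 'e) endo_field \<times> ('a, 'e) endo_field \<Rightarrow> bool"
  where "almost_hypercomplex_structure A = (\<lambda>(J1, J2, J3).
    almost_complex_structure A J1 \<and> almost_complex_structure A J2 \<and>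
    almost_complex_structure A J3 \<and>
    anticommuting A J1 J2 \<and> anticommuting A J1 J3 \<and> anticommuting A J2 J3 \<and>
    is_composition A J3 J1 J2)"

definition pseudo_hermitian_metric ::
  "('a, 'e::euclidean_space) chart set \<Rightarrow>
   ('a, 'e) endo_field \<times> ('a, 'e) endo_field \<times> ('a, 'e) endo_field \<Rightarrow>
   ('a, 'e) bilin_field \<Rightarrow> bool"
  where "pseudo_hermitian_metric A = (\<lambda>(J1, J2, J3) g. pseudo_riemannian_metric A g \<and>
    (\<forall>p. \<forall>x\<in>tangent_space A p. \<forall>y\<in>tangent_space A p.
       g p (J1 p x) (J1 p y) = g p x y \<and>
       - g p (J2 p x) (J2 p y) = g p x y \<and>
       - g p (J3 p x) (J3 p y) = g p x y))"

text \<open>\<open>b\<close> is the tensor associated with \<open>g\<close> and \<open>J\<close>: \<open>b(x, y) = g(J x, y)\<close>.\<close>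

definition associated_tensor ::
  "('a, 'e::euclidean_space) chart set \<Rightarrow> ('a, 'e) bilin_field \<Rightarrow> ('a, 'e) endo_field \<Rightarrow>
   ('a, 'e) bilin_field \<Rightarrow> bool"
  where "associated_tensor A g J b \<longleftrightarrow>
    (\<forall>p. \<forall>x\<in>tangent_space A p. \<forall>y\<in>tangent_space A p. b p x y = g p (J p x) y)"

definition almost_hypercomplex_pseudo_hermitian_manifold ::
  "('a::{t2_space, second_countable_topology}, 'e::euclidean_space) chart set \<Rightarrow>
   ('a, 'e) endo_field \<times> ('a, 'e) endo_field \<times> ('a, 'e) endo_field \<Rightarrow>
   ('a, 'e) bilin_field \<times> ('a, 'e) bilin_field \<times> ('a, 'e) bilin_field \<times> ('a, 'e) bilin_field \<Rightarrow>
   bool"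
  where "almost_hypercomplex_pseudo_hermitian_manifold A =
    (\<lambda>(J1, J2, J3) (g, \<Phi>, g2, g3).
      smooth_manifold A \<and>
      almost_hypercomplex_structure A (J1, J2, J3) \<and>
      pseudo_hermitian_metric A (J1, J2, J3) g \<and>
      smooth_bilinear_field A \<Phi> \<and> associated_tensor A g J1 \<Phi> \<and>
      smooth_bilinear_field A g2 \<and> associated_tensor A g J2 g2 \<and>
      smooth_bilinear_field A g3 \<and> associated_tensor A g J3 g3)"

end

theory Submission
  imports Defs
begin

text \<open>At each point the values of \<open>X1, \<dots>, X4\<close> are \<open>g\<close>-orthonormal, hence independent, hence a
  basis of the four-dimensional tangent space. All algebraic identities therefore only have to be
  checked on this frame. For smoothness, Cramer's rule shows that
  the coefficients of the coordinate vectors with respect to the frame are smooth, so it suffices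
  that \<open>J\<close> sends the frame to smooth fields, or that \<open>b\<close> is constant on it.\<close>

section \<open>Calculus of smooth maps\<close>

text \<open>The independence that matters is pointwise: relations with arbitrary real coefficients
  at a single point must be trivial, which is stronger than independence of vector fields over the
  reals. It comes from the metric, since pairing a vanishing combination with one frame vector
  isolates plus or minus one coefficient. Smoothness of the frame comes from its span being the Lie
  algebra. Smoothness of a tensor field is measured on coordinate vectors, whereas \<open>g\<close>
  and the \<open>J\<close> are known on the frame only. Comparing the two inverts the matrix of
  frame components, so the calculus has to reach determinants and quotients. A further constraint
  shapes the linear algebra: tensor fields are functions on a larger type and are linear only on
  tangent vectors. Every expansion therefore carries membership in \<open>tangent_space A p\<close>,
  and identities are obtained by comparing two fields of the same type on the frame.\<close>

lemma Ck_SucD: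
  assumes "Ck (Suc k) S f" "open S" "x \<in> S"
  shows "(f has_derivative frechet_derivative f (at x)) (at x)"
  using assms by (metis Ck.simps(2) differentiable_on_eq_differentiable_at frechet_derivative_works)

text \<open>On an open set the full derivative at a point depends only on nearby values, so the
  derivatives of \<open>f\<close> and \<open>g\<close> agree on \<open>S\<close> too. This is why
  the induction leaves both functions arbitrary.\<close>

lemma Ck_cong:
  assumes "open S" "Ck k S f" "\<And>x. x \<in> S \<Longrightarrow> f x = g x"
  shows "Ck k S g"
  using assms(2,3)
proof (induction k arbitrary: f g)
  case 0
  then show ?case using continuous_on_cong by (metis Ck.simps(1))
next
  case (Suc k)
  have deriv: "(g has_derivative frechet_derivative f (at x)) (at x)" if "x \<in> S" for x
    using has_derivative_transform_within_open[OF Ck_SucD[OF Suc.prems(1) assms(1) that] assms(1) that]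
      Suc.prems(2) by blast
  then have "g differentiable_on S"
    unfolding differentiable_on_def differentiable_def using has_derivative_at_withinI by blast
  moreover have "Ck k S (\<lambda>x. frechet_derivative g (at x) v)" for v
  proof (rule Suc.IH)
    show "Ck k S (\<lambda>x. frechet_derivative f (at x) v)" using Suc.prems(1) by simp
  qed (simp add: frechet_derivative_at[OF deriv])
  ultimately show ?case by simp
qed

text \<open>Lets the closure proofs exhibit a derivative \<open>D\<close> by the usual rules;
  uniqueness of the derivative replaces the chosen \<open>frechet_derivative\<close> by
  \<open>D\<close>.\<close>

lemma Ck_Suc_has_derivative:
  assumes "open S" "\<And>x. x \<in> S \<Longrightarrow> (f has_derivative D x) (at x)" "\<And>v. Ck k S (\<lambda>x. D x v)"
  shows "Ck (Suc k) S f"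
proof -
  have "f differentiable_on S"
    unfolding differentiable_on_def differentiable_def
    using assms(2) has_derivative_at_withinI by blast
  moreover have "Ck k S (\<lambda>x. frechet_derivative f (at x) v)" for v
    by (rule Ck_cong[OF assms(1) assms(3)[of v]]) (simp add: frechet_derivative_at[OF assms(2)])
  ultimately show ?thesis by simp
qed

lemma Ck_lower: "Ck (Suc k) S f \<Longrightarrow> Ck k S f"
  by (induction k arbitrary: f) (auto intro: differentiable_imp_continuous_on)

lemma Ck_const: "open S \<Longrightarrow> Ck k S (\<lambda>x. a)"
proof (induction k arbitrary: a)
  case (Suc k)
  show ?case by (rule Ck_Suc_has_derivative[OF Suc.prems, where D = "\<lambda>x v. 0"]) (use Suc in auto)
qed auto

lemma Ck_add:
  assumes "open S" "Ck k S f" "Ck k S g"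
  shows "Ck k S (\<lambda>x. f x + g x)"
  using assms(2,3)
proof (induction k arbitrary: f g)
  case 0
  then show ?case by (auto intro: continuous_intros)
next
  case (Suc k)
  show ?case
    by (rule Ck_Suc_has_derivative[OF assms(1) has_derivative_add[OF Ck_SucD Ck_SucD]])
       (use Suc assms(1) in auto)
qed

lemma Ck_bounded_linear:
  assumes "open S" "bounded_linear h" "Ck k S f"
  shows "Ck k S (\<lambda>x. h (f x))"
  using assms(3)
proof (induction k arbitrary: f)
  case 0
  then show ?case using bounded_linear.continuous_on[OF assms(2)] by simp
next
  case (Suc k)
  show ?case
    by (rule Ck_Suc_has_derivative[OF assms(1) bounded_linear.has_derivative[OF assms(2) Ck_SucD]])
       (use Suc assms(1) in auto)
qed

lemma Ck_bounded_bilinear: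
  assumes "open S" "bounded_bilinear h" "Ck k S f" "Ck k S g"
  shows "Ck k S (\<lambda>x. h (f x) (g x))"
  using assms(3,4)
proof (induction k arbitrary: f g)
  case 0
  then show ?case using bounded_bilinear.continuous_on[OF assms(2)] by simp
next
  case (Suc k)
  show ?case
  proof (rule Ck_Suc_has_derivative[OF assms(1) bounded_bilinear.FDERIV[OF assms(2) Ck_SucD Ck_SucD]])
    \<comment> \<open>Each term of the product rule keeps one factor undifferentiated;
      \<open>Ck_lower\<close> brings that factor down to order \<open>k\<close>.\<close>
    show "Ck k S (\<lambda>x. h (f x) (frechet_derivative g (at x) v) + h (frechet_derivative f (at x) v) (g x))" for v
      by (intro Ck_add[OF assms(1)] Suc.IH) (use Suc.prems Ck_lower in auto)
  qed (use Suc assms(1) in auto)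
qed

text \<open>The derivative of the inverse is a product containing the inverse again, so the
  induction runs over \<open>k\<close> for a fixed \<open>f\<close>, and its hypothesis concerns the
  very same function.\<close>

lemma Ck_inverse:
  fixes f :: "'e::euclidean_space \<Rightarrow> real"
  assumes "open S" "Ck k S f" "\<And>x. x \<in> S \<Longrightarrow> f x \<noteq> 0"
  shows "Ck k S (\<lambda>x. inverse (f x))"
  using assms(2)
proof (induction k)
  case 0
  then show ?case using assms(3) by (auto intro: continuous_intros)
next
  case (Suc k)
  show ?case
  proof (rule Ck_Suc_has_derivative[OF assms(1)])
    show "((\<lambda>x. inverse (f x)) has_derivative
        (\<lambda>v. - (inverse (f x) * frechet_derivative f (at x) v * inverse (f x)))) (at x)" if "x \<in> S" for x
      using Deriv.has_derivative_inverse[OF assms(3)[OF that] Ck_SucD[OF Suc.prems assms(1) that]] .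
    show "Ck k S (\<lambda>x. - (inverse (f x) * frechet_derivative f (at x) v * inverse (f x)))" for v
      by (intro Ck_bounded_linear[OF assms(1) bounded_linear_minus[OF bounded_linear_ident]]
          Ck_bounded_bilinear[OF assms(1) bounded_bilinear_mult] Suc.IH)
        (use Suc.prems Ck_lower in auto)
  qed
qed

section \<open>Closure properties of smooth maps, up to determinants\<close>

lemma smooth_on_cong: "open S \<Longrightarrow> smooth_on S f \<Longrightarrow> (\<And>x. x \<in> S \<Longrightarrow> f x = g x) \<Longrightarrow> smooth_on S g"
  unfolding smooth_on_def using Ck_cong by blast

lemma smooth_on_const: "open S \<Longrightarrow> smooth_on S (\<lambda>x. a)"
  unfolding smooth_on_def using Ck_const by blast

lemma smooth_on_add:
  "open S \<Longrightarrow> smooth_on S f \<Longrightarrow> smooth_on S g \<Longrightarrow> smooth_on S (\<lambda>x. f x + g x)"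
  unfolding smooth_on_def using Ck_add by blast

lemma smooth_on_sum:
  assumes "open S" "\<And>i. i \<in> I \<Longrightarrow> smooth_on S (f i)"
  shows "smooth_on S (\<lambda>x. \<Sum>i\<in>I. f i x)"
  using assms(2)
by (induction I rule: infinite_finite_induct)
    (auto intro: smooth_on_const smooth_on_add simp: assms(1))

lemma smooth_on_bounded_linear:
  "open S \<Longrightarrow> bounded_linear h \<Longrightarrow> smooth_on S f \<Longrightarrow> smooth_on S (\<lambda>x. h (f x))"
  unfolding smooth_on_def using Ck_bounded_linear by blast

lemma smooth_on_scaleR:
  "open S \<Longrightarrow> smooth_on S f \<Longrightarrow> smooth_on S g \<Longrightarrow> smooth_on S (\<lambda>x. f x *\<^sub>R g x)"
  unfolding smooth_on_def using Ck_bounded_bilinear[OF _ bounded_bilinear_scaleR] by blast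

lemma smooth_on_mult:
  fixes f g :: "'e::euclidean_space \<Rightarrow> real"
  shows "open S \<Longrightarrow> smooth_on S f \<Longrightarrow> smooth_on S g \<Longrightarrow> smooth_on S (\<lambda>x. f x * g x)"
  using smooth_on_scaleR[of S f g] by simp

lemma smooth_on_prod:
  fixes f :: "'i \<Rightarrow> 'e::euclidean_space \<Rightarrow> real"
  assumes "open S" "\<And>i. i \<in> I \<Longrightarrow> smooth_on S (f i)"
  shows "smooth_on S (\<lambda>x. \<Prod>i\<in>I. f i x)"
  using assms(2)
  by (induction I rule: infinite_finite_induct)
    (auto intro: smooth_on_const smooth_on_mult simp: assms(1))

lemma smooth_on_divide:
  fixes f g :: "'e::euclidean_space \<Rightarrow> real"
  assumes "open S" "smooth_on S f" "smooth_on S g" "\<And>x. x \<in> S \<Longrightarrow> g x \<noteq> 0"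
  shows "smooth_on S (\<lambda>x. f x / g x)"
proof -
  have "smooth_on S (\<lambda>x. inverse (g x))"
    using assms Ck_inverse unfolding smooth_on_def by blast
  from smooth_on_mult[OF assms(1,2) this] show ?thesis by (simp add: divide_inverse)
qed

text \<open>By the Leibniz formula the determinant is a polynomial in the entries.\<close>

lemma smooth_on_det:
  fixes M :: "'e::euclidean_space \<Rightarrow> real^'n^'n"
  assumes "open S" "\<And>i j. smooth_on S (\<lambda>x. M x $ i $ j)"
  shows "smooth_on S (\<lambda>x. det (M x))"
  unfolding det_def
  by (intro smooth_on_sum smooth_on_mult smooth_on_const smooth_on_prod assms)

section \<open>Charts and tangent spaces\<close>

lemma chart_inv_map: "is_chart c \<Longrightarrow> p \<in> chart_dom c \<Longrightarrow> chart_inv c (chart_map c p) = p"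
  unfolding is_chart_def by (meson homeomorphism_apply1)

lemma chart_map_inv: "is_chart c \<Longrightarrow> x \<in> chart_img c \<Longrightarrow> chart_map c (chart_inv c x) = x"
  unfolding is_chart_def by (meson homeomorphism_apply2)

lemma chart_inv_in_dom: "x \<in> chart_img c \<Longrightarrow> chart_inv c x \<in> chart_dom c"
  unfolding chart_img_def chart_inv_def by (rule inv_into_into)

text \<open>Such images are the domains of transition maps; their openness turns differentiability
  on the set into differentiability at each of its points.\<close>

lemma open_chart_map_image:
  assumes "is_chart c" "open U"
  shows "open (chart_map c ` (chart_dom c \<inter> U))"
proof -
  have "openin (top_of_set (chart_dom c)) (chart_dom c \<inter> U)"
    using assms(2) by auto
  then have "openin (top_of_set (chart_img c)) (chart_map c ` (chart_dom c \<inter> U))"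
    using assms(1) homeomorphism_imp_open_map unfolding is_chart_def by blast
  then show ?thesis
    using assms(1) openin_open_trans unfolding is_chart_def by blast
qed

lemma atlas_is_chart: "smooth_manifold A \<Longrightarrow> c \<in> A \<Longrightarrow> is_chart c"
  by (simp add: smooth_manifold_def)

lemma atlas_open_img: "smooth_manifold A \<Longrightarrow> c \<in> A \<Longrightarrow> open (chart_img c)"
  by (simp add: smooth_manifold_def is_chart_def)

lemma chart_at:
  assumes "smooth_manifold A"
  obtains c where "c \<in> A" "p \<in> chart_dom c"
  using assms unfolding smooth_manifold_def by (metis UNIV_I UN_E)

lemma transition_has_derivative:
  assumes "smooth_manifold A" "c \<in> A" "d \<in> A" "p \<in> chart_dom c" "p \<in> chart_dom d"
  shows "(transition c d has_derivative frechet_derivative (transition c d) (at (chart_map c p)))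
    (at (chart_map c p))"
proof (rule Ck_SucD)
  show "Ck (Suc 0) (chart_map c ` (chart_dom c \<inter> chart_dom d)) (transition c d)"
    using assms(1-3) unfolding smooth_manifold_def smooth_on_def by blast
  show "open (chart_map c ` (chart_dom c \<inter> chart_dom d))"
    using assms(1-3) atlas_is_chart[OF assms(1)] open_chart_map_image
    unfolding is_chart_def by blast
qed (use assms in auto)

lemma linear_transition_derivative:
  assumes "smooth_manifold A" "c \<in> A" "d \<in> A" "p \<in> chart_dom c" "p \<in> chart_dom d"
  shows "linear (frechet_derivative (transition c d) (at (chart_map c p)))"
  using has_derivative_linear transition_has_derivative[OF assms] by blast

text \<open>The chain rule for passing from \<open>c\<close> to \<open>e\<close> through
  \<open>d\<close>. It is exactly the compatibility that makes \<open>coord_vector\<close> a tangent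
  vector.\<close>

lemma transition_derivative_cocycle:
  assumes A: "smooth_manifold A" and "c \<in> A" "d \<in> A" "e \<in> A"
    and p: "p \<in> chart_dom c" "p \<in> chart_dom d" "p \<in> chart_dom e"
  shows "frechet_derivative (transition c e) (at (chart_map c p)) u =
    frechet_derivative (transition d e) (at (chart_map d p))
      (frechet_derivative (transition c d) (at (chart_map c p)) u)"
proof -
  note charts = atlas_is_chart[OF A \<open>c \<in> A\<close>] atlas_is_chart[OF A \<open>d \<in> A\<close>]
  have *: "transition c d (chart_map c p) = chart_map d p"
    using chart_inv_map[OF charts(1) p(1)] by (simp add: transition_def)
  have "(transition d e \<circ> transition c d has_derivative
      frechet_derivative (transition d e) (at (chart_map d p)) \<circ>
      frechet_derivative (transition c d) (at (chart_map c p))) (at (chart_map c p))"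
    by (rule diff_chain_at) (use * transition_has_derivative[OF A] assms in auto)
  then have "(transition c e has_derivative
      frechet_derivative (transition d e) (at (chart_map d p)) \<circ>
      frechet_derivative (transition c d) (at (chart_map c p))) (at (chart_map c p))"
  \<comment> \<open>The composite agrees with \<open>transition c e\<close> only over the overlap of
    \<open>c\<close> and \<open>d\<close>, which is enough because the derivative is local.\<close>
  proof (rule has_derivative_transform_within_open)
    show "open (chart_map c ` (chart_dom c \<inter> chart_dom d))"
      using charts open_chart_map_image unfolding is_chart_def by blast
    show "(transition d e \<circ> transition c d) x = transition c e x"
      if "x \<in> chart_map c ` (chart_dom c \<inter> chart_dom d)" for x
      using that chart_inv_map[OF charts(1)] chart_inv_map[OF charts(2)]
      by (auto simp: transition_def)
  qed (use p in auto)
  from frechet_derivative_at[OF this, symmetric] show ?thesis by simp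
qed

lemma coord_vector_in_tangent_space:
  assumes "smooth_manifold A" "c \<in> A" "p \<in> chart_dom c"
  shows "coord_vector A c u p \<in> tangent_space A p"
  unfolding tangent_space_def mem_Collect_eq
proof (intro conjI allI impI ballI)
  fix d e assume "d \<in> A" "e \<in> A" and "p \<in> chart_dom d \<and> p \<in> chart_dom e"
  then show "coord_vector A c u p e =
      frechet_derivative (transition d e) (at (chart_map d p)) (coord_vector A c u p d)"
    using transition_derivative_cocycle[OF assms(1,2) \<open>d \<in> A\<close> \<open>e \<in> A\<close> assms(3), of u]
    by (simp add: coord_vector_def)
qed (auto simp: coord_vector_def)

lemma coord_vector_self:
  assumes A: "smooth_manifold A" and "c \<in> A" "p \<in> chart_dom c"
  shows "coord_vector A c u p c = u"
proof -
  have "(transition c c has_derivative (\<lambda>x. x)) (at (chart_map c p))"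
  proof (rule has_derivative_transform_within_open[OF has_derivative_ident])
    show "open (chart_img c)" using assms atlas_open_img by blast
    show "x = transition c c x" if "x \<in> chart_img c" for x
      using that chart_map_inv[OF atlas_is_chart[OF A \<open>c \<in> A\<close>]] by (simp add: transition_def)
  qed (use assms in \<open>auto simp: chart_img_def\<close>)
  from frechet_derivative_at[OF this, symmetric] show ?thesis
    using assms by (simp add: coord_vector_def)
qed

text \<open>Compatibility under transitions determines all components around \<open>p\<close> from a
  single one, and the others are 0. Equations between tangent vectors thus become equations between
  coordinate vectors in one chart.\<close>

lemma tangent_space_eqI:
  assumes "v \<in> tangent_space A p" "w \<in> tangent_space A p" "c \<in> A" "p \<in> chart_dom c" "v c = w c"
  shows "v = w"
proof
  fix d show "v d = w d"
    using assms unfolding tangent_space_def mem_Collect_eq by metis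
qed

lemma subspace_tangent_space:
  assumes A: "smooth_manifold A"
  shows "subspace (tangent_space A p)"
proof (rule subspaceI)
  note lin = linear_transition_derivative[OF A]
  have outside: "u c = 0" if "u \<in> tangent_space A p" "c \<notin> A \<or> p \<notin> chart_dom c" for u c
    using that unfolding tangent_space_def by blast
  have inside: "u d = frechet_derivative (transition c d) (at (chart_map c p)) (u c)"
    if "u \<in> tangent_space A p" "c \<in> A" "d \<in> A" "p \<in> chart_dom c" "p \<in> chart_dom d" for u c d
    using that unfolding tangent_space_def by blast
  show "0 \<in> tangent_space A p"
    by (simp add: tangent_space_def linear_0[OF lin])
  fix v assume v: "v \<in> tangent_space A p"
  {
    fix w assume w: "w \<in> tangent_space A p"
    show "v + w \<in> tangent_space A p"
      unfolding tangent_space_def mem_Collect_eq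
    proof (intro conjI allI impI ballI)
      fix c d assume "c \<in> A" "d \<in> A" "p \<in> chart_dom c \<and> p \<in> chart_dom d"
      then show "(v + w) d = frechet_derivative (transition c d) (at (chart_map c p)) ((v + w) c)"
        using inside[OF v, of c d] inside[OF w, of c d] linear_add[OF lin, of c d p]
        by (simp only: plus_fun_apply)
    qed (simp add: outside[OF v] outside[OF w])
  }
  fix r
  show "r *\<^sub>R v \<in> tangent_space A p"
    unfolding tangent_space_def mem_Collect_eq
  proof (intro conjI allI impI ballI)
    fix c d assume "c \<in> A" "d \<in> A" "p \<in> chart_dom c \<and> p \<in> chart_dom d"
    then show "(r *\<^sub>R v) d = frechet_derivative (transition c d) (at (chart_map c p)) ((r *\<^sub>R v) c)"
      using inside[OF v, of c d] linear_scale[OF lin, of c d p]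
      by (simp only: scaleR_fun_def)
  qed (simp add: outside[OF v] scaleR_fun_def)
qed

section \<open>Linear algebra of tensor fields that are linear on tangent spaces only\<close>

lemma endomorphism_fieldI:
  assumes "\<And>p v. v \<in> tangent_space A p \<Longrightarrow> J p v \<in> tangent_space A p"
    and "\<And>p r v. v \<in> tangent_space A p \<Longrightarrow> J p (r *\<^sub>R v) = r *\<^sub>R J p v"
    and "\<And>p v w. v \<in> tangent_space A p \<Longrightarrow> w \<in> tangent_space A p \<Longrightarrow> J p (v + w) = J p v + J p w"
  shows "endomorphism_field A J"
  unfolding endomorphism_field_def by (intro allI ballI conjI assms)

lemma endomorphism_fieldD:
  assumes "endomorphism_field A J" "v \<in> tangent_space A p"
  shows endomorphism_field_in: "J p v \<in> tangent_space A p"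
    and endomorphism_field_scaleR: "J p (r *\<^sub>R v) = r *\<^sub>R J p v"
    and endomorphism_field_add: "w \<in> tangent_space A p \<Longrightarrow> J p (v + w) = J p v + J p w"
  proof -
  note J = assms(1)[unfolded endomorphism_field_def, THEN spec, THEN bspec, OF assms(2)]
  show "J p v \<in> tangent_space A p" using J by (rule conjunct1)
  show "J p (r *\<^sub>R v) = r *\<^sub>R J p v" using J[THEN conjunct2, THEN conjunct1] by (rule spec)
  show "w \<in> tangent_space A p \<Longrightarrow> J p (v + w) = J p v + J p w"
    using J[THEN conjunct2, THEN conjunct2] by (rule bspec)
qed

lemma bilinear_fieldI:
  assumes "\<And>p r v w. v \<in> tangent_space A p \<Longrightarrow> w \<in> tangent_space A p \<Longrightarrow> b p (r *\<^sub>R v) w = r * b p v w"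
    and "\<And>p r v w. v \<in> tangent_space A p \<Longrightarrow> w \<in> tangent_space A p \<Longrightarrow> b p v (r *\<^sub>R w) = r * b p v w"
    and "\<And>p u v w. u \<in> tangent_space A p \<Longrightarrow> v \<in> tangent_space A p \<Longrightarrow> w \<in> tangent_space A p \<Longrightarrow>
      b p (u + v) w = b p u w + b p v w"
    and "\<And>p u v w. u \<in> tangent_space A p \<Longrightarrow> v \<in> tangent_space A p \<Longrightarrow> w \<in> tangent_space A p \<Longrightarrow>
      b p w (u + v) = b p w u + b p w v"
  shows "bilinear_field A b"
  unfolding bilinear_field_def by (intro allI ballI conjI assms)

lemma bilinear_fieldD:
  assumes "bilinear_field A b" "v \<in> tangent_space A p" "w \<in> tangent_space A p"
  shows bilinear_field_scaleR_left: "b p (r *\<^sub>R v) w = r * b p v w"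
    and bilinear_field_scaleR_right: "b p v (r *\<^sub>R w) = r * b p v w"
    and bilinear_field_add_left: "u \<in> tangent_space A p \<Longrightarrow> b p (u + v) w = b p u w + b p v w"
    and bilinear_field_add_right: "u \<in> tangent_space A p \<Longrightarrow> b p w (u + v) = b p w u + b p w v"
  proof -
  note b = assms(1)[unfolded bilinear_field_def, THEN spec, THEN bspec, OF assms(2), THEN bspec, OF assms(3)]
  show "b p (r *\<^sub>R v) w = r * b p v w" using b[THEN conjunct1, THEN spec] by (rule conjunct1)
  show "b p v (r *\<^sub>R w) = r * b p v w" using b[THEN conjunct1, THEN spec] by (rule conjunct2)
  show "u \<in> tangent_space A p \<Longrightarrow> b p (u + v) w = b p u w + b p v w"
    using b[THEN conjunct2, THEN bspec] by (rule conjunct1)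
  show "u \<in> tangent_space A p \<Longrightarrow> b p w (u + v) = b p w u + b p w v"
    using b[THEN conjunct2, THEN bspec] by (rule conjunct2)
qed

text \<open>Additivity of \<open>J p\<close> is available only between tangent vectors, so the
  induction must also keep each partial sum inside the tangent space.\<close>

lemma endomorphism_field_sum:
  assumes "smooth_manifold A" "endomorphism_field A J" "\<And>i. i \<in> I \<Longrightarrow> v i \<in> tangent_space A p"
  shows "J p (\<Sum>i\<in>I. a i *\<^sub>R v i) = (\<Sum>i\<in>I. a i *\<^sub>R J p (v i))"
proof -
  note T = subspace_tangent_space[OF assms(1), of p]
  have zero: "J p 0 = 0"
    using endomorphism_field_scaleR[OF assms(2) subspace_0[OF T], of 0] by simp
  show ?thesis
    using assms(3)
  proof (induction I rule: infinite_finite_induct)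
    case (insert i I)
    have v: "v i \<in> tangent_space A p" using insert.prems by blast
    have sum: "(\<Sum>i\<in>I. a i *\<^sub>R v i) \<in> tangent_space A p"
      using insert.prems T by (auto intro!: subspace_sum subspace_scale)
    have "J p (a i *\<^sub>R v i + (\<Sum>i\<in>I. a i *\<^sub>R v i)) =
        a i *\<^sub>R J p (v i) + J p (\<Sum>i\<in>I. a i *\<^sub>R v i)"
      by (simp only: endomorphism_field_add[OF assms(2) subspace_scale[OF T v] sum]
          endomorphism_field_scaleR[OF assms(2) v])
    moreover have "J p (\<Sum>i\<in>I. a i *\<^sub>R v i) = (\<Sum>i\<in>I. a i *\<^sub>R J p (v i))"
      using insert.IH insert.prems by blast
    ultimately show ?case
      by (simp only: sum.insert[OF insert.hyps])
  qed (auto simp: zero)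
qed

lemma bilinear_field_sum_left:
  assumes "smooth_manifold A" "bilinear_field A b" "\<And>i. i \<in> I \<Longrightarrow> v i \<in> tangent_space A p"
    and "w \<in> tangent_space A p"
  shows "b p (\<Sum>i\<in>I. a i *\<^sub>R v i) w = (\<Sum>i\<in>I. a i * b p (v i) w)"
proof -
  note T = subspace_tangent_space[OF assms(1), of p]
  have zero: "b p 0 w = 0"
    using bilinear_field_scaleR_left[OF assms(2) subspace_0[OF T] assms(4), of 0] by simp
  show ?thesis
    using assms(3)
  proof (induction I rule: infinite_finite_induct)
    case (insert i I)
    have v: "v i \<in> tangent_space A p" using insert.prems by blast
    have sum: "(\<Sum>i\<in>I. a i *\<^sub>R v i) \<in> tangent_space A p"
      using insert.prems T by (auto intro!: subspace_sum subspace_scale)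
    have "b p (a i *\<^sub>R v i + (\<Sum>i\<in>I. a i *\<^sub>R v i)) w =
        a i * b p (v i) w + b p (\<Sum>i\<in>I. a i *\<^sub>R v i) w"
      by (simp only: bilinear_field_add_left[OF assms(2) sum assms(4) subspace_scale[OF T v]]
          bilinear_field_scaleR_left[OF assms(2) v assms(4)])
    moreover have "b p (\<Sum>i\<in>I. a i *\<^sub>R v i) w = (\<Sum>i\<in>I. a i * b p (v i) w)"
      using insert.IH insert.prems by blast
    ultimately show ?case
      by (simp only: sum.insert[OF insert.hyps])
  qed (auto simp: zero)
qed

text \<open>Carries left-slot facts over to the right slot, and presents the symmetry of a metric as
  equality of two bilinear fields.\<close>

lemma bilinear_field_swap: "bilinear_field A b \<Longrightarrow> bilinear_field A (\<lambda>p v w. b p w v)"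
  by (rule bilinear_fieldI) (simp_all only: bilinear_fieldD)

lemma bilinear_field_sum:
  assumes "smooth_manifold A" "bilinear_field A b"
    and "\<And>i. i \<in> I \<Longrightarrow> v i \<in> tangent_space A p" "\<And>j. j \<in> K \<Longrightarrow> w j \<in> tangent_space A p"
  shows "b p (\<Sum>i\<in>I. x i *\<^sub>R v i) (\<Sum>j\<in>K. y j *\<^sub>R w j) =
    (\<Sum>i\<in>I. \<Sum>j\<in>K. x i * y j * b p (v i) (w j))"
proof -
  have "(\<Sum>j\<in>K. y j *\<^sub>R w j) \<in> tangent_space A p"
    using assms(4) subspace_tangent_space[OF assms(1)] by (auto intro!: subspace_sum subspace_scale)
  then have "b p (\<Sum>i\<in>I. x i *\<^sub>R v i) (\<Sum>j\<in>K. y j *\<^sub>R w j) = (\<Sum>i\<in>I. x i * b p (v i) (\<Sum>j\<in>K. y j *\<^sub>R w j))"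
    using bilinear_field_sum_left[OF assms(1,2)] assms(3) by blast
  also have "\<dots> = (\<Sum>i\<in>I. x i * (\<Sum>j\<in>K. y j * b p (v i) (w j)))"
    using bilinear_field_sum_left[OF assms(1) bilinear_field_swap[OF assms(2)], of K w p] assms(3,4)
    by (intro sum.cong) auto
  finally show ?thesis by (simp add: sum_distrib_left mult.assoc)
qed

text \<open>This and the following closure facts make both sides of each structural identity fields
  of the same type, so that the identity can be tested on a frame.\<close>

lemma endomorphism_field_compose:
  assumes "endomorphism_field A J" "endomorphism_field A K"
  shows "endomorphism_field A (\<lambda>p v. J p (K p v))"
  by (rule endomorphism_fieldI)
    (simp_all only: endomorphism_fieldD[OF assms(1)] endomorphism_fieldD[OF assms(2)])

lemma endomorphism_field_uminus:
  assumes "smooth_manifold A" "endomorphism_field A J"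
  shows "endomorphism_field A (\<lambda>p v. - J p v)"
proof (rule endomorphism_fieldI)
  show "- J p v \<in> tangent_space A p" if "v \<in> tangent_space A p" for p v
    using subspace_neg[OF subspace_tangent_space[OF assms(1)] endomorphism_field_in[OF assms(2) that]] .
qed (simp_all only: endomorphism_fieldD[OF assms(2)] scaleR_minus_right minus_add_distrib)

lemma endomorphism_field_id: "endomorphism_field A (\<lambda>p v. v)"
  by (rule endomorphism_fieldI) (rule refl | assumption)+

lemma bilinear_field_pullback:
  assumes "bilinear_field A b" "endomorphism_field A J" "endomorphism_field A K"
  shows "bilinear_field A (\<lambda>p v w. b p (J p v) (K p w))"
  by (rule bilinear_fieldI)
    (simp_all only: endomorphism_fieldD[OF assms(2)] endomorphism_fieldD[OF assms(3)]
      bilinear_fieldD[OF assms(1)])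

lemma bilinear_field_uminus: "bilinear_field A b \<Longrightarrow> bilinear_field A (\<lambda>p v w. - b p v w)"
  by (rule bilinear_fieldI) (simp_all only: bilinear_fieldD mult_minus_right minus_add_distrib)

lemma endomorphism_field_neg:
  assumes "endomorphism_field A J" "v \<in> tangent_space A p"
  shows "J p (- v) = - J p v"
  using endomorphism_field_scaleR[OF assms, of "- 1"] by simp

lemma bilinear_field_neg:
  assumes "bilinear_field A b" "v \<in> tangent_space A p" "w \<in> tangent_space A p"
  shows "b p (- v) w = - b p v w" "b p v (- w) = - b p v w"
  using bilinear_field_scaleR_left[OF assms, of "- 1"] bilinear_field_scaleR_right[OF assms, of "- 1"]
  by simp_all

text \<open>A composition such as \<open>J3\<close>, or a tensor associated with \<open>g\<close>,
  is prescribed on tangent vectors only. Linearity still transfers, because sums and multiples of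
  tangent vectors are tangent.\<close>

lemma endomorphism_field_cong:
  assumes "smooth_manifold A" "endomorphism_field A J"
    and "\<And>p v. v \<in> tangent_space A p \<Longrightarrow> K p v = J p v"
  shows "endomorphism_field A K"
  by (rule endomorphism_fieldI)
    (simp_all only: assms(3) endomorphism_fieldD[OF assms(2)]
      subspace_add[OF subspace_tangent_space[OF assms(1)]]
      subspace_scale[OF subspace_tangent_space[OF assms(1)]])

lemma bilinear_field_cong:
  assumes "smooth_manifold A" "bilinear_field A b"
    and "\<And>p v w. v \<in> tangent_space A p \<Longrightarrow> w \<in> tangent_space A p \<Longrightarrow> b' p v w = b p v w"
  shows "bilinear_field A b'"
  by (rule bilinear_fieldI)
    (simp_all only: assms(3) bilinear_fieldD[OF assms(2)]
      subspace_add[OF subspace_tangent_space[OF assms(1)]]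
      subspace_scale[OF subspace_tangent_space[OF assms(1)]])

section \<open>Smooth frames\<close>

lemma sum_fun_apply: "(\<Sum>i\<in>I. f i) x = (\<Sum>i\<in>I. f i x)"
  by (induction I rule: infinite_finite_induct) simp_all

lemma scaleR_fun_apply: "(r *\<^sub>R f) x = r *\<^sub>R f x"
  by (simp add: scaleR_fun_def)

text \<open>The frame is indexed by the coordinate type \<open>'n\<close> itself, so its component
  matrix in a chart is square and determinants apply.\<close>

locale smooth_frame =
  fixes A :: "('a::{t2_space, second_countable_topology}, real^'n::finite) chart set"
    and E :: "'n \<Rightarrow> ('a, real^'n) vector_field"
  assumes manifold: "smooth_manifold A"
    and smooth_E: "\<And>i. smooth_vector_field A (E i)"
    and frame_independent: "\<And>p a i. (\<Sum>j\<in>UNIV. a j *\<^sub>R E j p) = 0 \<Longrightarrow> a i = 0"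
begin

lemma E_in_tangent_space: "E i p \<in> tangent_space A p"
  using smooth_E unfolding smooth_vector_field_def by blast

lemma sum_E_in_tangent_space: "(\<Sum>i\<in>UNIV. a i *\<^sub>R E i p) \<in> tangent_space A p"
  using E_in_tangent_space subspace_tangent_space[OF manifold]
  by (auto intro!: subspace_sum subspace_scale)

lemma endomorphism_field_frame:
  assumes "endomorphism_field A J"
  shows "J p (\<Sum>i\<in>UNIV. a i *\<^sub>R E i p) = (\<Sum>i\<in>UNIV. a i *\<^sub>R J p (E i p))"
  by (rule endomorphism_field_sum[OF manifold assms E_in_tangent_space])

lemma bilinear_field_frame:
  assumes "bilinear_field A b"
  shows "b p (\<Sum>i\<in>UNIV. x i *\<^sub>R E i p) (\<Sum>j\<in>UNIV. y j *\<^sub>R E j p) =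
    (\<Sum>i\<in>UNIV. \<Sum>j\<in>UNIV. x i * y j * b p (E i p) (E j p))"
  by (rule bilinear_field_sum[OF manifold assms E_in_tangent_space E_in_tangent_space])

text \<open>The frame fields are the columns, so applying the matrix to coefficients gives the chart
  component of the corresponding combination.\<close>

definition frame_matrix :: "('a, real^'n) chart \<Rightarrow> 'a \<Rightarrow> real^'n^'n"
  where "frame_matrix c p = (\<chi> i j. E j p c $ i)"

lemma frame_matrix_mult: "frame_matrix c p *v a = (\<Sum>i\<in>UNIV. (a $ i) *\<^sub>R E i p) c"
  by (simp add: frame_matrix_def vec_eq_iff matrix_vector_mult_def sum_fun_apply scaleR_fun_apply
      mult.commute)

text \<open>A kernel vector would give a combination of the frame with zero component in
  \<open>c\<close>, hence a zero tangent vector, against pointwise independence.\<close>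

lemma det_frame_matrix:
  assumes "c \<in> A" "p \<in> chart_dom c"
  shows "det (frame_matrix c p) \<noteq> 0"
proof -
  have "a = 0" if "frame_matrix c p *v a = 0" for a
  proof -
    have "(\<Sum>i\<in>UNIV. (a $ i) *\<^sub>R E i p) = 0"
      using tangent_space_eqI[OF sum_E_in_tangent_space subspace_0[OF subspace_tangent_space[OF manifold]] assms]
        that by (simp add: frame_matrix_mult)
    then show ?thesis using frame_independent[where a = "($) a"] by (simp add: vec_eq_iff)
  qed
  then show ?thesis
    by (metis invertible_det_nz invertible_left_inverse matrix_left_invertible_ker)
qed

text \<open>The coefficients are given by Cramer's rule, which makes their smoothness evident.\<close>

definition frame_coeff :: "('a, real^'n) chart \<Rightarrow> real^'n \<Rightarrow> 'a \<Rightarrow> 'n \<Rightarrow> real"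
  where "frame_coeff c u p k =
    det (\<chi> i j. if j = k then u $ i else frame_matrix c p $ i $ j) / det (frame_matrix c p)"

lemma tangent_vector_frame_coeff:
  assumes "v \<in> tangent_space A p" "c \<in> A" "p \<in> chart_dom c"
  shows "v = (\<Sum>i\<in>UNIV. frame_coeff c (v c) p i *\<^sub>R E i p)"
proof -
  have "frame_matrix c p *v (\<chi> k. frame_coeff c (v c) p k) = v c"
    unfolding frame_coeff_def using cramer[OF det_frame_matrix[OF assms(2,3)]] by blast
  then show ?thesis
    by (intro tangent_space_eqI[OF assms(1) sum_E_in_tangent_space assms(2,3)])
       (simp add: frame_matrix_mult)
qed

lemma tangent_vector_in_frame:
  assumes "v \<in> tangent_space A p"
  obtains a where "v = (\<Sum>i\<in>UNIV. a i *\<^sub>R E i p)"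
proof -
  obtain c where "c \<in> A" "p \<in> chart_dom c" using chart_at[OF manifold] .
  then show thesis by (rule that[OF tangent_vector_frame_coeff[OF assms]])
qed

text \<open>In its own chart a coordinate vector has the constant component \<open>u\<close>, so its
  coefficients vary with \<open>x\<close> through the frame matrix alone.\<close>

lemma coord_vector_in_frame:
  assumes "c \<in> A" "x \<in> chart_img c"
  shows "coord_vector A c u (chart_inv c x) =
    (\<Sum>i\<in>UNIV. frame_coeff c u (chart_inv c x) i *\<^sub>R E i (chart_inv c x))"
proof -
  note dom = chart_inv_in_dom[OF assms(2)]
  show ?thesis
    using tangent_vector_frame_coeff[OF coord_vector_in_tangent_space[OF manifold assms(1) dom, of u]
        assms(1) dom]
    unfolding coord_vector_self[OF manifold assms(1) dom] .
qed

lemma smooth_frame_coeff: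
  assumes "c \<in> A"
  shows "smooth_on (chart_img c) (\<lambda>x. frame_coeff c u (chart_inv c x) k)"
proof -
  note op = atlas_open_img[OF manifold assms]
  have entry: "smooth_on (chart_img c) (\<lambda>x. frame_matrix c (chart_inv c x) $ i $ j)" for i j
    using smooth_on_bounded_linear[OF op bounded_linear_vec_nth,
        of "\<lambda>x. E j (chart_inv c x) c" i] smooth_E[of j] assms
    by (simp add: frame_matrix_def smooth_vector_field_def)
  have "smooth_on (chart_img c)
      (\<lambda>x. (\<chi> i j. if j = k then u $ i else frame_matrix c (chart_inv c x) $ i $ j) $ i $ j)" for i j
    by (cases "j = k") (simp_all add: entry smooth_on_const[OF op])
  then show ?thesis
    unfolding frame_coeff_def
    by (intro smooth_on_divide smooth_on_det op entry det_frame_matrix[OF assms] chart_inv_in_dom)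
qed

lemma smooth_endomorphism_fieldI:
  assumes J: "endomorphism_field A J" and smooth: "\<And>i. smooth_vector_field A (\<lambda>p. J p (E i p))"
  shows "smooth_endomorphism_field A J"
  unfolding smooth_endomorphism_field_def
proof (intro conjI ballI J)
  fix c and u :: "real^'n" assume c: "c \<in> A"
  note op = atlas_open_img[OF manifold c]
  have "smooth_on (chart_img c) (\<lambda>x. \<Sum>i\<in>UNIV.
      frame_coeff c u (chart_inv c x) i *\<^sub>R J (chart_inv c x) (E i (chart_inv c x)) c)"
    using smooth c unfolding smooth_vector_field_def
    by (intro smooth_on_sum smooth_on_scaleR op smooth_frame_coeff) auto
  then show "smooth_on (chart_img c)
      (\<lambda>x. J (chart_inv c x) (coord_vector A c u (chart_inv c x)) c)"
    by (rule smooth_on_cong[OF op])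
      (simp only: coord_vector_in_frame[OF c] endomorphism_field_frame[OF J]
        sum_fun_apply scaleR_fun_apply)
qed

lemma smooth_bilinear_fieldI:
  assumes b: "bilinear_field A b" and const: "\<And>p i j. b p (E i p) (E j p) = m i j"
  shows "smooth_bilinear_field A b"
  unfolding smooth_bilinear_field_def
proof (intro conjI ballI b)
  fix c and u w :: "real^'n" assume c: "c \<in> A"
  note op = atlas_open_img[OF manifold c]
  have "smooth_on (chart_img c) (\<lambda>x. \<Sum>i\<in>UNIV. \<Sum>j\<in>UNIV.
      frame_coeff c u (chart_inv c x) i * frame_coeff c w (chart_inv c x) j * m i j)"
    by (intro smooth_on_sum smooth_on_mult op smooth_frame_coeff smooth_on_const c)
  then show "smooth_on (chart_img c) (\<lambda>x. b (chart_inv c x) (coord_vector A c u (chart_inv c x))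
      (coord_vector A c w (chart_inv c x)))"
    by (rule smooth_on_cong[OF op])
      (simp add: coord_vector_in_frame[OF c] const bilinear_field_frame[OF b])
qed

lemma endomorphism_field_eqI:
  assumes "endomorphism_field A J" "endomorphism_field A K" "\<And>i. J p (E i p) = K p (E i p)"
    and "v \<in> tangent_space A p"
  shows "J p v = K p v"
proof -
  obtain a where "v = (\<Sum>i\<in>UNIV. a i *\<^sub>R E i p)"
    using tangent_vector_in_frame[OF assms(4)] .
  then show ?thesis
    by (simp only: endomorphism_field_frame assms)
qed

lemma bilinear_field_eqI:
  assumes "bilinear_field A b" "bilinear_field A b'"
    and "\<And>i j. b p (E i p) (E j p) = b' p (E i p) (E j p)"
    and "v \<in> tangent_space A p" "w \<in> tangent_space A p"
  shows "b p v w = b' p v w"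
proof -
  obtain x where "v = (\<Sum>i\<in>UNIV. x i *\<^sub>R E i p)"
    using tangent_vector_in_frame[OF assms(4)] .
  moreover obtain y where "w = (\<Sum>i\<in>UNIV. y i *\<^sub>R E i p)"
    using tangent_vector_in_frame[OF assms(5)] .
  ultimately show ?thesis
    by (simp only: bilinear_field_frame assms)
qed

text \<open>The metric definition speaks of a basis as a set. Distinct indices must give distinct
  vectors for sums over that set to be reindexed and for negative vectors to be counted by
  index.\<close>

lemma inj_frame: "inj (\<lambda>i. E i p)"
proof (rule injI, rule ccontr)
  fix i j assume eq: "E i p = E j p" and "i \<noteq> j"
  \<comment> \<open>The coefficients of the relation \<open>E i p - E j p = 0\<close>.\<close>
  define a :: "'n \<Rightarrow> real" where "a k = (if k = i then 1 else if k = j then - 1 else 0)" for k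
  have "(\<Sum>k\<in>UNIV. a k *\<^sub>R E k p) = (\<Sum>k\<in>{i, j}. a k *\<^sub>R E k p)"
    by (rule sum.mono_neutral_right) (auto simp: a_def)
  also have "\<dots> = 0" using \<open>i \<noteq> j\<close> eq by (simp add: a_def)
  finally have "a i = 0" by (rule frame_independent)
  then show False by (simp add: a_def)
qed

lemma independent_frame: "independent (range (\<lambda>i. E i p))"
proof -
  have "f v = 0"
    if "(\<Sum>v\<in>range (\<lambda>i. E i p). f v *\<^sub>R v) = 0" "v \<in> range (\<lambda>i. E i p)" for f v
    using that frame_independent[where a = "\<lambda>i. f (E i p)"]
    by (auto simp: sum.reindex[OF inj_frame] o_def)
  then show ?thesis by (subst dependent_finite) auto
qed

lemma span_frame: "span (range (\<lambda>i. E i p)) = tangent_space A p"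
proof
  show "span (range (\<lambda>i. E i p)) \<subseteq> tangent_space A p"
    using E_in_tangent_space subspace_tangent_space[OF manifold] by (intro span_minimal) auto
  show "tangent_space A p \<subseteq> span (range (\<lambda>i. E i p))"
  proof
    fix v assume "v \<in> tangent_space A p"
    then obtain a where "v = (\<Sum>i\<in>UNIV. a i *\<^sub>R E i p)"
      by (rule tangent_vector_in_frame)
    then show "v \<in> span (range (\<lambda>i. E i p))"
      by (elim ssubst, intro span_sum span_scale span_base rangeI)
  qed
qed

lemma pseudo_riemannian_metricI:
  assumes g: "bilinear_field A g"
    and frame: "\<And>p i j. g p (E i p) (E j p) = (if i = j then s i else 0)"
    and signs: "\<And>i. s i = 1 \<or> s i = - 1"
  shows "pseudo_riemannian_metric A g"
  unfolding pseudo_riemannian_metric_def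
proof (intro conjI allI ballI impI)
  show "smooth_bilinear_field A g" using g frame by (rule smooth_bilinear_fieldI)
  show "g p v w = g p w v" if "v \<in> tangent_space A p" "w \<in> tangent_space A p" for p v w
    by (rule bilinear_field_eqI[OF g bilinear_field_swap[OF g] _ that]) (simp add: frame)
  show "v = 0" if v: "v \<in> tangent_space A p" and zero: "\<forall>w\<in>tangent_space A p. g p v w = 0" for p v
  proof -
    obtain a where a: "v = (\<Sum>i\<in>UNIV. a i *\<^sub>R E i p)" using tangent_vector_in_frame[OF v] .
    have "a i = 0" for i
    proof -
      \<comment> \<open>Orthogonality leaves a single term; the sign \<open>s i\<close> is nonzero,
        so a null pairing forces the coefficient to vanish.\<close>
      have "a i * s i = g p v (E i p)"
        by (simp add: a frame if_distrib[of "(*) _"]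
            bilinear_field_sum_left[OF manifold g E_in_tangent_space E_in_tangent_space]
            cong: if_cong)
      then show ?thesis using zero E_in_tangent_space signs[of i] by auto
    qed
    then show ?thesis using a by simp
  qed
  show "\<exists>k. \<forall>p. \<exists>B. finite B \<and> independent B \<and> span B = tangent_space A p \<and>
      (\<forall>v\<in>B. \<forall>w\<in>B. v \<noteq> w \<longrightarrow> g p v w = 0) \<and> (\<forall>v\<in>B. g p v v = 1 \<or> g p v v = - 1) \<and>
      card {v\<in>B. g p v v = - 1} = k"
  \<comment> \<open>The witness for \<open>k\<close> is \<open>card {i. s i = - 1}\<close>: the
    signs do not depend on the point, hence neither does the signature.\<close>
  proof (intro exI allI conjI)
    fix p
    have "{v \<in> range (\<lambda>i. E i p). g p v v = - 1} = (\<lambda>i. E i p) ` {i. s i = - 1}"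
      by (auto simp: frame)
    then show "card {v \<in> range (\<lambda>i. E i p). g p v v = - 1} = card {i. s i = - 1}"
      using card_image[OF inj_on_subset[OF inj_frame]] by simp
  qed (use independent_frame span_frame signs in \<open>auto simp: frame\<close>)
qed

lemma almost_complex_structureI:
  assumes J: "endomorphism_field A J" and "\<And>i. smooth_vector_field A (\<lambda>p. J p (E i p))"
    and "\<And>p i. J p (J p (E i p)) = - E i p"
  shows "almost_complex_structure A J"
  unfolding almost_complex_structure_def
proof (intro conjI allI ballI)
  show "smooth_endomorphism_field A J" using assms(1,2) by (rule smooth_endomorphism_fieldI)
  show "J p (J p v) = - v" if "v \<in> tangent_space A p" for p v
    by (rule endomorphism_field_eqI[OF endomorphism_field_compose[OF J J]
          endomorphism_field_uminus[OF manifold endomorphism_field_id] assms(3) that])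
qed

lemma anticommutingI:
  assumes "endomorphism_field A J" "endomorphism_field A K"
    and "\<And>p i. J p (K p (E i p)) = - K p (J p (E i p))"
  shows "anticommuting A J K"
  unfolding anticommuting_def
  using endomorphism_field_eqI[OF endomorphism_field_compose[OF assms(1,2)]
      endomorphism_field_uminus[OF manifold endomorphism_field_compose[OF assms(2,1)]] assms(3)]
  by blast

end

theorem theorem3p2:
  fixes L :: "'a::{t2_space, second_countable_topology} monoid"
    and A :: "('a, real^4) chart set"
    and X1 X2 X3 X4 :: "('a, real^4) vector_field"
    and l1 l2 l3 l4 :: real
    and g \<Phi> g2 g3 :: "('a, real^4) bilin_field"
    and J1 J2 J3 :: "('a, real^4) endo_field"
  assumes lie: "lie_group L A"
    and conn: "connected (UNIV :: 'a set)"
    and params: "(l1, l2, l3, l4) \<noteq> (0, 0, 0, 0)"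
    and basis_distinct: "distinct [X1, X2, X3, X4]"
    and basis_independent: "independent {X1, X2, X3, X4}"
    and basis_span: "span {X1, X2, X3, X4} = lie_algebra L A"
    and br13: "lie_bracket A X1 X3 = l2 *\<^sub>R X2 + l4 *\<^sub>R X4"
    and br24: "lie_bracket A X2 X4 = l1 *\<^sub>R X1 + l3 *\<^sub>R X3"
    and br23: "lie_bracket A X2 X3 = - (l2 *\<^sub>R X1) - l3 *\<^sub>R X4"
    and br34: "lie_bracket A X3 X4 = - (l4 *\<^sub>R X1) + l3 *\<^sub>R X2"
    and br41: "lie_bracket A X4 X1 = l1 *\<^sub>R X2 + l4 *\<^sub>R X3"
    and br21: "lie_bracket A X2 X1 = - (l2 *\<^sub>R X3) + l1 *\<^sub>R X4"
    and g_bilinear: "bilinear_field A g"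
    and g_diag: "\<And>p. g p (X1 p) (X1 p) = 1" "\<And>p. g p (X2 p) (X2 p) = 1"
      "\<And>p. - g p (X3 p) (X3 p) = 1" "\<And>p. - g p (X4 p) (X4 p) = 1"
    and g_orth: "\<And>p V W. V \<in> {X1, X2, X3, X4} \<Longrightarrow> W \<in> {X1, X2, X3, X4} \<Longrightarrow> V \<noteq> W \<Longrightarrow>
      g p (V p) (W p) = 0"
    and J1_linear: "endomorphism_field A J1"
    and J1_frame: "\<And>p. J1 p (X1 p) = X2 p" "\<And>p. J1 p (X2 p) = - X1 p"
      "\<And>p. J1 p (X3 p) = - X4 p" "\<And>p. J1 p (X4 p) = X3 p"
    and J2_linear: "endomorphism_field A J2"
    and J2_frame: "\<And>p. J2 p (X1 p) = X3 p" "\<And>p. J2 p (X2 p) = X4 p"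
      "\<And>p. J2 p (X3 p) = - X1 p" "\<And>p. J2 p (X4 p) = - X2 p"
    and J3_def: "is_composition A J3 J1 J2"
    and Phi_def: "associated_tensor A g J1 \<Phi>"
    and g2_def: "associated_tensor A g J2 g2"
    and g3_def: "associated_tensor A g J3 g3"
  shows "almost_hypercomplex_pseudo_hermitian_manifold A (J1, J2, J3) (g, \<Phi>, g2, g3) \<and>
    manifold_dim A = 4"
proof -
  have A: "smooth_manifold A" using lie by (simp add: lie_group_def)
  have smooth_span: "smooth_vector_field A X" if "X \<in> span {X1, X2, X3, X4}" for X
    using that basis_span by (simp add: lie_algebra_def)
  \<comment> \<open>Negatives are included because the structures send frame fields to frame fields
    up to sign; the pointwise form matches the shape of \<open>J p (E i p)\<close>.\<close>
  have smooth: "smooth_vector_field A X" "smooth_vector_field A (\<lambda>p. - X p)"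
    if "X \<in> {X1, X2, X3, X4}" for X
    using smooth_span[OF span_base[OF that]] smooth_span[OF span_neg[OF span_base[OF that]]]
    unfolding fun_Compl_def[of X] .
  have T: "X p \<in> tangent_space A p" if "X \<in> {X1, X2, X3, X4}" for X p
    using smooth(1)[OF that] by (simp add: smooth_vector_field_def)
  \<comment> \<open>The final branch serves the index \<open>4\<close>, which equals
    \<open>0\<close> in the type \<open>4\<close>.\<close>
  define E :: "4 \<Rightarrow> ('a, real^4) vector_field"
    where "E i = (if i = 1 then X1 else if i = 2 then X2 else if i = 3 then X3 else X4)" for i
  have E: "E 1 = X1" "E 2 = X2" "E 3 = X3" "E 4 = X4" by (auto simp: E_def)
  define s :: "4 \<Rightarrow> real" where "s i = (if i = 1 \<or> i = 2 then 1 else - 1)" for i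
  have ET: "E i \<in> {X1, X2, X3, X4}" for i by (auto simp: E_def)
  have orth: "g p (V p) (W p) = 0" if "V \<noteq> W" "V \<in> {X1, X2, X3, X4}" "W \<in> {X1, X2, X3, X4}" for p V W
    using g_orth that by blast
  have frame: "g p (E i p) (E j p) = (if i = j then s i else 0)" for p i j
  proof -
    \<comment> \<open>The quantified form lets \<open>forall_4\<close> split the claim into its
      sixteen cases.\<close>
    have "\<forall>i j. g p (E i p) (E j p) = (if i = j then s i else 0)"
      unfolding forall_4 E using g_diag[of p] basis_distinct by (auto simp: s_def orth)
    then show ?thesis by blast
  qed
  interpret smooth_frame A E
  proof
    fix p a i assume zero: "(\<Sum>j\<in>UNIV. a j *\<^sub>R E j p) = 0"
    \<comment> \<open>Pairing the relation with \<open>E i p\<close> leaves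
      \<open>a i * s i\<close>, with \<open>s i\<close> equal to 1 or -1.\<close>
    have "g p (\<Sum>j\<in>UNIV. a j *\<^sub>R E j p) (E i p) = (\<Sum>j\<in>UNIV. a j * g p (E j p) (E i p))"
      by (rule bilinear_field_sum_left[OF A g_bilinear T[OF ET] T[OF ET]])
    moreover have "g p 0 (E i p) = 0"
      using bilinear_field_scaleR_left[OF g_bilinear T[OF ET] T[OF ET], where r = 0] by simp
    ultimately have "0 = (\<Sum>j\<in>UNIV. a j * (if j = i then s j else 0))"
      unfolding zero frame by simp
    then have "a i * s i = 0" by (simp add: if_distrib[of "(*) _"] cong: if_cong)
    then show "a i = 0" by (auto simp: s_def split: if_splits)
  qed (use A smooth(1)[OF ET] in auto)
  have J3_eq: "J3 p v = J1 p (J2 p v)" if "v \<in> tangent_space A p" for p v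
    using J3_def that unfolding is_composition_def by blast
  have J3_linear: "endomorphism_field A J3"
    using endomorphism_field_cong[OF A endomorphism_field_compose[OF J1_linear J2_linear] J3_eq] .
  note T' = T[of X1, simplified] T[of X2, simplified] T[of X3, simplified] T[of X4, simplified]
  note neg = endomorphism_field_neg[OF J1_linear] endomorphism_field_neg[OF J2_linear]
    endomorphism_field_neg[OF J3_linear]
  have J3_frame: "J3 p (X1 p) = - X4 p" "J3 p (X2 p) = X3 p" "J3 p (X3 p) = - X2 p" "J3 p (X4 p) = X1 p" for p
    using J3_eq T' J1_frame J2_frame neg by auto
  note J_frame = J1_frame J2_frame J3_frame
  have smooth_J: "smooth_vector_field A (\<lambda>p. J1 p (E i p))" "smooth_vector_field A (\<lambda>p. J2 p (E i p))"
    "smooth_vector_field A (\<lambda>p. J3 p (E i p))" for i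
    by (auto simp: E_def J_frame smooth)
  have square: "J1 p (J1 p (E i p)) = - E i p" "J2 p (J2 p (E i p)) = - E i p"
    "J3 p (J3 p (E i p)) = - E i p" for p i
    by (simp_all add: E_def J_frame neg T')
  have acs: "almost_complex_structure A J1" "almost_complex_structure A J2"
    "almost_complex_structure A J3"
    using almost_complex_structureI[OF J1_linear smooth_J(1) square(1)]
      almost_complex_structureI[OF J2_linear smooth_J(2) square(2)]
      almost_complex_structureI[OF J3_linear smooth_J(3) square(3)] .
  have anticommute: "J1 p (J2 p (E i p)) = - J2 p (J1 p (E i p))"
    "J1 p (J3 p (E i p)) = - J3 p (J1 p (E i p))"
    "J2 p (J3 p (E i p)) = - J3 p (J2 p (E i p))" for p i
    by (simp_all add: E_def J_frame neg T')
  have anti: "anticommuting A J1 J2" "anticommuting A J1 J3" "anticommuting A J2 J3"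
    using anticommutingI[OF J1_linear J2_linear anticommute(1)]
      anticommutingI[OF J1_linear J3_linear anticommute(2)]
      anticommutingI[OF J2_linear J3_linear anticommute(3)] .
  \<comment> \<open>Orthonormality phrased for fields instead of indices, usable once a structure
    has permuted the frame.\<close>
  have gX: "g p (V p) (W p) = (if V = W then if V = X1 \<or> V = X2 then 1 else - 1 else 0)"
    if "V \<in> {X1, X2, X3, X4}" "W \<in> {X1, X2, X3, X4}" for p V W
    using that g_diag[of p] g_orth[of V W p] basis_distinct by auto
  have gneg: "g p (- v) w = - g p v w" "g p v (- w) = - g p v w"
    if "v \<in> tangent_space A p" "w \<in> tangent_space A p" for p v w
    using bilinear_field_neg[OF g_bilinear that] .
  \<comment> \<open>When both arguments of \<open>g\<close> carry a minus sign, removing the first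
    one by \<open>gneg\<close> requires the still negated other argument to be tangent.\<close>
  have TN: "- X p \<in> tangent_space A p" if "X \<in> {X1, X2, X3, X4}" for X p
    using subspace_neg[OF subspace_tangent_space[OF A] T[OF that]] .
  have herm: "g p (J1 p v) (J1 p w) = g p v w" "- g p (J2 p v) (J2 p w) = g p v w"
    "- g p (J3 p v) (J3 p w) = g p v w"
    if v: "v \<in> tangent_space A p" and w: "w \<in> tangent_space A p" for p v w
  proof -
    have neq: "X1 \<noteq> X2" "X1 \<noteq> X3" "X1 \<noteq> X4" "X2 \<noteq> X3" "X2 \<noteq> X4" "X3 \<noteq> X4"
      using basis_distinct by auto
    note pb = bilinear_field_pullback[OF g_bilinear]
    \<comment> \<open>Up to sign, \<open>J1\<close> preserves the pairs \<open>X1, X2\<close>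
      (square 1) and \<open>X3, X4\<close> (square -1), while \<open>J2\<close> and
      \<open>J3\<close> exchange them. Hence \<open>J1\<close> is an isometry and the other two
      reverse the sign of \<open>g\<close>.\<close>
    have frames: "\<forall>i j. g p (J1 p (E i p)) (J1 p (E j p)) = g p (E i p) (E j p)"
      "\<forall>i j. - g p (J2 p (E i p)) (J2 p (E j p)) = g p (E i p) (E j p)"
      "\<forall>i j. - g p (J3 p (E i p)) (J3 p (E j p)) = g p (E i p) (E j p)"
      unfolding forall_4 E J_frame
      by (simp_all add: gneg T' TN gX neq neq[symmetric])
    show "g p (J1 p v) (J1 p w) = g p v w"
      by (rule bilinear_field_eqI[OF pb[OF J1_linear J1_linear] g_bilinear _ v w]) (use frames in blast)
    show "- g p (J2 p v) (J2 p w) = g p v w"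
      by (rule bilinear_field_eqI[OF bilinear_field_uminus[OF pb[OF J2_linear J2_linear]] g_bilinear _ v w])
        (use frames in blast)
    show "- g p (J3 p v) (J3 p w) = g p v w"
      by (rule bilinear_field_eqI[OF bilinear_field_uminus[OF pb[OF J3_linear J3_linear]] g_bilinear _ v w])
        (use frames in blast)
  qed
  \<comment> \<open>In the third assumption the field \<open>V\<close> and its sign are chosen
    before the point. Therefore \<open>b\<close> on frame vectors is plus or minus
    \<open>g p (V p) (E j p)\<close>, constant in \<open>p\<close>.\<close>
  have assoc: "smooth_bilinear_field A b"
    if J: "endomorphism_field A J" and b: "associated_tensor A g J b"
      and Jf: "\<And>i. \<exists>V\<in>{X1, X2, X3, X4}. (\<forall>p. J p (E i p) = V p) \<or> (\<forall>p. J p (E i p) = - V p)" for J b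
  proof (rule smooth_bilinear_fieldI)
    have b': "b p v w = g p (J p v) w" if "v \<in> tangent_space A p" "w \<in> tangent_space A p" for p v w
      using b that by (simp add: associated_tensor_def)
    show "bilinear_field A b"
      using bilinear_field_cong[OF A bilinear_field_pullback[OF g_bilinear J endomorphism_field_id] b'] .
    \<comment> \<open>The point \<open>undefined\<close> serves as an arbitrary base point naming
      the constant value.\<close>
    show "b p (E i p) (E j p) = b undefined (E i undefined) (E j undefined)" for p i j
    proof -
      obtain V where V: "V \<in> {X1, X2, X3, X4}" "(\<forall>p. J p (E i p) = V p) \<or> (\<forall>p. J p (E i p) = - V p)"
        using Jf by blast
      then show ?thesis
        by (auto simp: b' E_in_tangent_space gneg T' gX[OF _ ET])
    qed
  qed
  have "pseudo_riemannian_metric A g"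
    by (rule pseudo_riemannian_metricI[OF g_bilinear frame]) (simp add: s_def)
  then have "pseudo_hermitian_metric A (J1, J2, J3) g"
    using herm by (simp add: pseudo_hermitian_metric_def)
  moreover have "smooth_bilinear_field A \<Phi>"
    by (rule assoc[OF J1_linear Phi_def]) (auto simp: E_def J_frame)
  moreover have "smooth_bilinear_field A g2"
    by (rule assoc[OF J2_linear g2_def]) (auto simp: E_def J_frame)
  moreover have "smooth_bilinear_field A g3"
    by (rule assoc[OF J3_linear g3_def]) (auto simp: E_def J_frame)
  ultimately show ?thesis
    using A acs anti J3_def Phi_def g2_def g3_def
    by (simp add: almost_hypercomplex_pseudo_hermitian_manifold_def almost_hypercomplex_structure_def
        manifold_dim_def)
qed

end
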